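(* Let $G$ be an abelian group and let $\theta=(\{X_t\}_{t\in G},\{h_t\}_{t\in G})$ be a topological partial action of $G$ on a compact Hausdorff space $X$ such that each $X_t$ is a clopen subset of $X$. Let $\mathcal{C}(X)\star G$ be the (algebraic) partial skew group ring of the partial action of $G$ on the algebra $\mathcal{C}(X)$ of continuous functions $X\to\mathbb{C}$ induced by $\theta$. Then $\mathcal{C}(X)\star G$ is simple if and only if $\theta$ is topologically free and minimal.
   Context: $G$ is a discrete group, written additively with identity $0$. A topological partial action of $G$ on $X$ is a pair $\theta=(\{X_t\}_{t\in G},\{h_t\}_{t\in G})$ where each $X_t\subseteq X$ is open, each $h_t:X_{-t}\to X_t$ is a homeomorphism, $X_0=X$, $h_0=\mathrm{id}_X$, $h_t(X_{-t}\cap X_s)=X_t\cap X_{t+s}$, and $h_t(h_s(x))=h_{t+s}(x)$ for all $x\in X_{-s}\cap X_{-s-t}$. A subset $V\subseteq X$ is $G$-invariant if $h_t(V\cap X_{-t})\subseteq V$ for all $t\in G$. $\theta$ is minimal if the only open $G$-invariant subsets of $X$ are $\emptyset$ and $X$. $\theta$ is topologically free if for all $t\neq0$ the set $F_t=\{x\in X_{-t}: h_t(x)=x\}$ has empty interior. The induced partial action $\alpha=(\{D_t\},\{\alpha_t\})$ of $G$ on $\mathcal{C}(X)$ is given by the ideals $D_t=\mathcal{C}_0(X_t)$, which (as $X_t$ is clopen) is $\{f\in\mathcal{C}(X): f(x)=0\ \forall x\notin X_t\}$, and the isomorphisms $\alpha_t:D_{-t}\to D_t$, $\alpha_t(f)=f\circ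 h_{-t}$ on $X_t$ and $0$ off $X_t$. The partial skew group ring $\mathcal{C}(X)\star G$ is the set of finite formal sums $\sum_{t\in G}a_t\delta_t$ with $a_t\in D_t$, with the obvious addition and with multiplication determined by $(a_t\delta_t)(b_s\delta_s)=\alpha_t(\alpha_{-t}(a_t)b_s)\delta_{t+s}$; it is an associative ring. A ring is simple if its only two-sided ideals (no topology involved) are $\{0\}$ and the whole ring. *)

theory Defs
  imports "HOL-Analysis.Analysis" "HOL-Algebra.Ideal"
begin

text \<open>
  A partial action of a group \<open>G\<close> on the space \<open>X\<close> is a pair of families \<open>U\<close>, \<open>h\<close> indexed by
  \<open>G\<close>, with \<open>h t : U (- t) \<rightarrow> U t\<close>. Each \<open>h t\<close> is a total HOL function; its values off
  \<open>U (- t)\<close> are irrelevant and never used.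
\<close>

locale topological_partial_action =
  fixes X :: "'x topology"
    and U :: "'g::group_add \<Rightarrow> 'x set"
    and h :: "'g \<Rightarrow> 'x \<Rightarrow> 'x"
  assumes open_domain: "openin X (U t)"
    and homeo: "homeomorphic_map (subtopology X (U (- t))) (subtopology X (U t)) (h t)"
    and domain_zero: "U 0 = topspace X"
    and map_zero: "x \<in> topspace X \<Longrightarrow> h 0 x = x"
    and image_inter: "h t ` (U (- t) \<inter> U s) = U t \<inter> U (t + s)"
    and map_add: "x \<in> U (- s) \<inter> U (- s - t) \<Longrightarrow> h t (h s x) = h (t + s) x"

definition invariant_set :: "('g::group_add \<Rightarrow> 'x set) \<Rightarrow> ('g \<Rightarrow> 'x \<Rightarrow> 'x) \<Rightarrow> 'x set \<Rightarrow> bool" where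
  "invariant_set U h V \<longleftrightarrow> (\<forall>t. h t ` (V \<inter> U (- t)) \<subseteq> V)"

definition minimal_action ::
    "'x topology \<Rightarrow> ('g::group_add \<Rightarrow> 'x set) \<Rightarrow> ('g \<Rightarrow> 'x \<Rightarrow> 'x) \<Rightarrow> bool" where
  "minimal_action X U h \<longleftrightarrow>
     (\<forall>V. openin X V \<and> invariant_set U h V \<longrightarrow> V = {} \<or> V = topspace X)"

definition topologically_free ::
    "'x topology \<Rightarrow> ('g::group_add \<Rightarrow> 'x set) \<Rightarrow> ('g \<Rightarrow> 'x \<Rightarrow> 'x) \<Rightarrow> bool" where
  "topologically_free X U h \<longleftrightarrow>
     (\<forall>t. t \<noteq> 0 \<longrightarrow> X interior_of {x \<in> U (- t). h t x = x} = {})"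

text \<open>
  An element of \<open>C(X)\<close> is represented by the HOL function that extends it by \<open>0\<close> outside
  \<open>topspace X\<close>, so that equal elements are equal as HOL functions.
\<close>

definition cont_functions :: "'x topology \<Rightarrow> ('x \<Rightarrow> complex) set" where
  "cont_functions X = {f. continuous_map X euclidean f \<and> (\<forall>x. x \<notin> topspace X \<longrightarrow> f x = 0)}"

text \<open>For clopen \<open>V\<close> this is \<open>C\<^sub>0(V)\<close>, viewed as an ideal of \<open>C(X)\<close>.\<close>

definition vanishing_ideal :: "'x topology \<Rightarrow> 'x set \<Rightarrow> ('x \<Rightarrow> complex) set" where
  "vanishing_ideal X V = {f \<in> cont_functions X. \<forall>x. x \<notin> V \<longrightarrow> f x = 0}"

definition induced_map ::
    "('g::group_add \<Rightarrow> 'x set) \<Rightarrow> ('g \<Rightarrow> 'x \<Rightarrow> 'x) \<Rightarrow> 'g \<Rightarrow> ('x \<Rightarrow> complex) \<Rightarrow> 'x \<Rightarrow> complex" where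
  "induced_map U h t f = (\<lambda>x. if x \<in> U t then f (h (- t) x) else 0)"

definition coeff_support :: "('g \<Rightarrow> 'x \<Rightarrow> complex) \<Rightarrow> 'g set" where
  "coeff_support a = {t. a t \<noteq> (\<lambda>x. 0)}"

text \<open>
  The formal sum of the \<open>a\<^sub>t \<delta>\<^sub>t\<close> is represented by its coefficient family \<open>a\<close>. The product is the
  biadditive extension of
  \<open>(a\<^sub>t \<delta>\<^sub>t) (b\<^sub>s \<delta>\<^sub>s) = \<alpha>\<^sub>t (\<alpha>\<^bsub>-t\<^esub> (a\<^sub>t) b\<^sub>s) \<delta>\<^bsub>t+s\<^esub>\<close>; its coefficient at \<open>r\<close> collects
  the finitely many pairs \<open>(t, s)\<close> in the supports with \<open>t + s = r\<close>.
\<close>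

definition skew_mult ::
    "('g::group_add \<Rightarrow> 'x set) \<Rightarrow> ('g \<Rightarrow> 'x \<Rightarrow> 'x) \<Rightarrow>
     ('g \<Rightarrow> 'x \<Rightarrow> complex) \<Rightarrow> ('g \<Rightarrow> 'x \<Rightarrow> complex) \<Rightarrow> 'g \<Rightarrow> 'x \<Rightarrow> complex" where
  "skew_mult U h a b = (\<lambda>r x.
     \<Sum>(t, s) \<in> {(t, s). t \<in> coeff_support a \<and> s \<in> coeff_support b \<and> t + s = r}.
       induced_map U h t (\<lambda>y. induced_map U h (- t) (a t) y * b s y) x)"

lemma skew_mult_monomials:
  "skew_mult U h (\<lambda>r. if r = t then a else (\<lambda>x. 0)) (\<lambda>r. if r = s then b else (\<lambda>x. 0)) =
   (\<lambda>r. if r = t + s then induced_map U h t (\<lambda>y. induced_map U h (- t) a y * b y) else (\<lambda>x. 0))"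
  (is "skew_mult U h ?a ?b = _")
proof (intro ext)
  fix r x
  let ?S = "{(t', s'). t' \<in> coeff_support ?a \<and> s' \<in> coeff_support ?b \<and> t' + s' = r}"
  have "?S = (if a \<noteq> (\<lambda>x. 0) \<and> b \<noteq> (\<lambda>x. 0) \<and> r = t + s then {(t, s)} else {})"
    by (auto simp: coeff_support_def split: if_splits)
  then show "skew_mult U h ?a ?b r x =
      (if r = t + s then induced_map U h t (\<lambda>y. induced_map U h (- t) a y * b y) else (\<lambda>x. 0)) x"
    unfolding skew_mult_def by (auto simp: induced_map_def)
qed

definition partial_skew_group_ring ::
    "'x topology \<Rightarrow> ('g::group_add \<Rightarrow> 'x set) \<Rightarrow> ('g \<Rightarrow> 'x \<Rightarrow> 'x) \<Rightarrow> ('g \<Rightarrow> 'x \<Rightarrow> complex) ring" where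
  "partial_skew_group_ring X U h =
     \<lparr> carrier = {a. (\<forall>t. a t \<in> vanishing_ideal X (U t)) \<and> finite (coeff_support a)},
       monoid.mult = skew_mult U h,
       one = (\<lambda>t x. if t = 0 \<and> x \<in> topspace X then 1 else 0),
       zero = (\<lambda>t x. 0),
       add = (\<lambda>a b t x. a t x + b t x) \<rparr>"

text \<open>The zero ring counts as simple, which matches the case of an empty space.\<close>

locale simple_ring = ring R for R (structure) +
  assumes trivial_ideals: "ideal I R \<Longrightarrow> I = {\<zero>} \<or> I = carrier R"

end

theory Submission
  imports Defs
begin

text \<open>
  The ring acts on functions on \<open>X\<close> by \<open>(a \<phi>)(x) = \<Sum>\<^sub>t a\<^sub>t(x) \<phi>(h\<^bsub>-t\<^esub>(x))\<close>. If \<open>h\<^sub>t\<close> is the identity on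
  a nonempty open set \<open>W\<close>, the kernel of this action contains \<open>f\<delta>\<^sub>0 - f\<delta>\<^sub>t\<close> for every \<open>f\<close> supported in
  \<open>W\<close>, but not the unit, so simplicity forces topological freeness; and an invariant open set yields
  the ideal of all elements whose coefficients vanish off it, so simplicity forces minimality.

  Conversely, a nonzero ideal contains some \<open>a\<close> with \<open>a\<^sub>0 \<noteq> 0\<close>. By topological freeness some open \<open>W\<close>
  on which \<open>a\<^sub>0\<close> does not vanish is moved off itself by every \<open>h\<^bsub>-t\<^esub>\<close> with \<open>t \<noteq> 0\<close> in the support of
  \<open>a\<close>; for \<open>f\<close> supported in \<open>W\<close> the product \<open>(f\<delta>\<^sub>0) a (f\<delta>\<^sub>0)\<close> is then the nonzero element
  \<open>f\<^sup>2a\<^sub>0\<delta>\<^sub>0\<close>. The points where some \<open>c\<close> with \<open>c\<delta>\<^sub>0\<close> in the ideal does not vanish form an open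
  invariant set, which is all of \<open>X\<close> by minimality; by compactness a finite sum of \<open>|c|\<^sup>2\<close> is invertible.
\<close>

section \<open>Convolution along the partial maps\<close>

text \<open>
  For arbitrary \<open>\<phi>\<close> this is a left module action: \<open>\<phi>\<close> in the ring gives the product, and
  \<open>\<phi>\<close> independent of the group element gives the action on functions on \<open>X\<close>.
\<close>

definition conv ::
    "('g::group_add \<Rightarrow> 'x \<Rightarrow> 'x) \<Rightarrow> ('g \<Rightarrow> 'x \<Rightarrow> complex) \<Rightarrow> ('g \<Rightarrow> 'x \<Rightarrow> complex) \<Rightarrow> 'g \<Rightarrow> 'x \<Rightarrow> complex"
  where "conv h a \<phi> = (\<lambda>r x. \<Sum>t\<in>coeff_support a. a t x * \<phi> (- t + r) (h (- t) x))"

definition monomial :: "'g \<Rightarrow> ('x \<Rightarrow> complex) \<Rightarrow> 'g \<Rightarrow> 'x \<Rightarrow> complex" where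
  "monomial t f = (\<lambda>r. if r = t then f else (\<lambda>x. 0))"

lemma coeff_support_zero: "t \<notin> coeff_support a \<Longrightarrow> a t x = 0"
  by (simp add: coeff_support_def)

text \<open>Lets elements with different supports be summed over one common finite index set: the
  added terms have coefficient 0.\<close>

lemma conv_superset:
  assumes "finite T" "coeff_support a \<subseteq> T"
  shows "conv h a \<phi> r x = (\<Sum>t\<in>T. a t x * \<phi> (- t + r) (h (- t) x))"
  unfolding conv_def using assms by (intro sum.mono_neutral_left) (auto simp: coeff_support_zero)

lemma coeff_support_monomial: "coeff_support (monomial t f) \<subseteq> {t}"
  by (auto simp: coeff_support_def monomial_def)

lemma conv_monomial_left: "conv h (monomial t f) \<phi> r x = f x * \<phi> (- t + r) (h (- t) x)"
  by (subst conv_superset[OF _ coeff_support_monomial]) (simp_all add: monomial_def)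

text \<open>The equation \<open>- t + r = s\<close> has the single solution
  \<open>t = r - s\<close>, so at most one term survives; if \<open>r - s\<close> lies outside the
  support, both sides are 0.\<close>

lemma conv_monomial_right:
  fixes a :: "'g::group_add \<Rightarrow> 'x \<Rightarrow> complex"
  assumes "finite (coeff_support a)"
  shows "conv h a (monomial s g) r x = a (r - s) x * g (h (- (r - s)) x)"
proof -
  have "- t + r = s \<longleftrightarrow> t = r - s" for t
    by (metis add_diff_cancel diff_add_cancel add_minus_cancel minus_add_cancel)
  then have eq: "a t x * monomial s g (- t + r) (h (- t) x) =
      (if t = r - s then a (r - s) x * g (h (- (r - s)) x) else 0)" for t
    by (simp add: monomial_def)
  have "conv h a (monomial s g) r x =
      (\<Sum>t\<in>insert (r - s) (coeff_support a). a t x * monomial s g (- t + r) (h (- t) x))"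
    using assms by (intro conv_superset) auto
  also have "\<dots> = a (r - s) x * g (h (- (r - s)) x)"
    unfolding eq using assms by (subst sum.delta) simp_all
  finally show ?thesis .
qed

lemma conv_add_left:
  assumes "finite (coeff_support a)" "finite (coeff_support b)"
  shows "conv h (\<lambda>t x. a t x + b t x) \<phi> r x = conv h a \<phi> r x + conv h b \<phi> r x"
proof -
  let ?T = "coeff_support a \<union> coeff_support b"
  have "coeff_support (\<lambda>t x. a t x + b t x) \<subseteq> ?T"
    by (auto simp: coeff_support_def)
  then show ?thesis
    using assms by (simp add: conv_superset[where T = ?T] distrib_right sum.distrib)
qed

lemma conv_add_right: "conv h a (\<lambda>t x. \<phi> t x + \<psi> t x) r x = conv h a \<phi> r x + conv h a \<psi> r x"
  by (simp add: conv_def distrib_left sum.distrib)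

section \<open>Continuous functions, vanishing ideals and bump functions\<close>

lemma continuous_map_complex_mult:
  fixes f g :: "'a \<Rightarrow> complex"
  assumes "continuous_map X euclidean f" "continuous_map X euclidean g"
  shows "continuous_map X euclidean (\<lambda>x. f x * g x)"
  using assms by (simp add: continuous_map_atin tendsto_mult)

text \<open>A preimage is an open piece inside \<open>V\<close> together with either nothing or the
  whole complement of \<open>V\<close>, which is open as \<open>V\<close> is closed.\<close>

lemma continuous_map_if_clopen:
  assumes V: "openin X V" "closedin X V" and f: "continuous_map (subtopology X V) Y f"
    and c: "c \<in> topspace Y"
  shows "continuous_map X Y (\<lambda>x. if x \<in> V then f x else c)"
proof -
  have V': "topspace (subtopology X V) = V"
    using openin_subset[OF V(1)] by auto
  have "openin X {x \<in> topspace X. (if x \<in> V then f x else c) \<in> W}" if W: "openin Y W" for W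
  proof -
    have "openin X {x \<in> V. f x \<in> W}"
      using openin_continuous_map_preimage[OF f W] by (simp only: V' openin_open_subtopology[OF V(1)])
    moreover have "openin X (if c \<in> W then topspace X - V else {})"
      using V(2) by auto
    moreover have "{x \<in> topspace X. (if x \<in> V then f x else c) \<in> W} =
        {x \<in> V. f x \<in> W} \<union> (if c \<in> W then topspace X - V else {})"
      using openin_subset[OF V(1)] by auto
    ultimately show ?thesis
      by (metis openin_Un)
  qed
  moreover have "f x \<in> topspace Y" if "x \<in> V" for x
    using that f V' by (auto simp: continuous_map_def)
  ultimately show ?thesis
    using c by (auto simp: continuous_map_def)
qed

lemma vanishing_ideal_sum:
  "(\<And>i. i \<in> I \<Longrightarrow> f i \<in> vanishing_ideal X V) \<Longrightarrow> finite I \<Longrightarrow> (\<lambda>x. \<Sum>i\<in>I. f i x) \<in> vanishing_ideal X V"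
  by (auto simp: vanishing_ideal_def cont_functions_def intro!: continuous_map_sum)

lemma vanishing_ideal_add:
  "f \<in> vanishing_ideal X V \<Longrightarrow> g \<in> vanishing_ideal X V \<Longrightarrow> (\<lambda>x. f x + g x) \<in> vanishing_ideal X V"
  by (auto simp: vanishing_ideal_def cont_functions_def intro!: continuous_map_add)

lemma vanishing_ideal_uminus:
  "f \<in> vanishing_ideal X V \<Longrightarrow> (\<lambda>x. - f x) \<in> vanishing_ideal X V"
  by (auto simp: vanishing_ideal_def cont_functions_def intro!: continuous_map_minus)

lemma zero_in_vanishing_ideal: "(\<lambda>x. 0) \<in> vanishing_ideal X V"
  by (auto simp: vanishing_ideal_def cont_functions_def)

lemma openin_nonzero:
  assumes "f \<in> cont_functions X"
  shows "openin X {x. f x \<noteq> 0}"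
proof -
  have "{x. f x \<noteq> 0} = {x \<in> topspace X. f x \<in> - {0}}"
    using assms by (auto simp: cont_functions_def)
  moreover have "openin X {x \<in> topspace X. f x \<in> - {0}}"
    using assms unfolding cont_functions_def by (intro openin_continuous_map_preimage) auto
  ultimately show ?thesis by simp
qed

text \<open>Compact Hausdorff spaces are completely regular: some real \<open>g\<close> is 0 at
  \<open>x\<close> and 1 off \<open>W\<close>, and \<open>1 - g\<close>, set to 0 outside the space,
  is the bump.\<close>

lemma compact_Hausdorff_bump:
  assumes "compact_space X" "Hausdorff_space X" "openin X W" "x \<in> W"
  obtains f where "f \<in> vanishing_ideal X W" "f x = 1"
proof -
  have "completely_regular_space X"
    using assms compact_Hausdorff_imp_regular_space compact_imp_locally_compact_space
      locally_compact_regular_imp_completely_regular_space by blast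
  then obtain g :: "'a \<Rightarrow> real" where g: "continuous_map X euclideanreal g" "g x = 0"
      "g ` (topspace X - W) \<subseteq> {1}"
    using assms unfolding completely_regular_space_alt' by metis
  define f :: "'a \<Rightarrow> complex" where "f = (\<lambda>y. if y \<in> topspace X then of_real (1 - g y) else 0)"
  have "continuous_map X euclidean (\<lambda>y. of_real (1 - g y) :: complex)"
    using g(1) by (simp add: continuous_map_atin tendsto_of_real tendsto_diff)
  then have "continuous_map X euclidean f"
    by (rule continuous_map_eq) (simp add: f_def)
  moreover have "W \<subseteq> topspace X" using assms openin_subset by blast
  ultimately have "f \<in> vanishing_ideal X W"
    using g(3) by (auto simp: vanishing_ideal_def cont_functions_def f_def)
  moreover have "f x = 1"
    using g(2) \<open>W \<subseteq> topspace X\<close> \<open>x \<in> W\<close> by (auto simp: f_def)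
  ultimately show thesis using that by blast
qed

section \<open>Partial actions with clopen domains\<close>

text \<open>Closedness of the domains makes extension by 0 from \<open>U t\<close> continuous; in
  particular \<open>indicator (U t)\<close> is an identity element of the ideal
  \<open>vanishing_ideal X (U t)\<close>.\<close>

locale clopen_partial_action = topological_partial_action X U h
  for X :: "'x topology" and U :: "'g::group_add \<Rightarrow> 'x set" and h :: "'g \<Rightarrow> 'x \<Rightarrow> 'x" +
  assumes closed_domain: "closedin X (U t)"
begin

abbreviation R where "R \<equiv> partial_skew_group_ring X U h"

lemma domain_subset: "U t \<subseteq> topspace X"
  using open_domain openin_subset by blast

lemma map_image: "h t ` U (- t) = U t"
  using image_inter[of t 0] domain_subset[of "- t"] by (simp add: domain_zero Int_absorb2)

lemma map_mem: "x \<in> U t \<Longrightarrow> h (- t) x \<in> U (- t)"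
  using map_image[of "- t"] by auto

lemma map_cancel: "x \<in> U t \<Longrightarrow> h t (h (- t) x) = x"
  using map_add[of x "- t" t] domain_subset[of t] by (auto simp: domain_zero map_zero)

text \<open>The point \<open>h (- t) x\<close> lies in \<open>U (- t) \<inter> U s\<close>, which
  \<open>h t\<close> carries onto \<open>U t \<inter> U (t + s)\<close>; so \<open>x\<close> is
  where the composition law applies.\<close>

lemma
  assumes "x \<in> U t" "h (- t) x \<in> U s"
  shows domain_compose: "x \<in> U (t + s)"
    and map_compose: "h (- s) (h (- t) x) = h (- (t + s)) x"
proof -
  have "h t (h (- t) x) \<in> h t ` (U (- t) \<inter> U s)"
    using assms map_mem by blast
  then show *: "x \<in> U (t + s)"
    using assms by (simp add: image_inter map_cancel)
  show "h (- s) (h (- t) x) = h (- (t + s)) x"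
    using map_add[of x "- t" "- s"] assms * by (simp add: minus_add)
qed

lemma continuous_map_partial: "continuous_map (subtopology X (U t)) X (h (- t))"
  using homeo[of "- t"] homeomorphic_imp_continuous_map continuous_map_into_fulltopology by fastforce

lemma openin_preimage:
  assumes "openin X B"
  shows "openin X {y \<in> U t. h (- t) y \<in> B}"
proof -
  have "openin (subtopology X (U t)) {y \<in> topspace (subtopology X (U t)). h (- t) y \<in> B}"
    using assms continuous_map_partial openin_continuous_map_preimage by blast
  also have "topspace (subtopology X (U t)) = U t"
    using domain_subset by auto
  finally show ?thesis
    by (simp add: openin_open_subtopology[OF open_domain])
qed

text \<open>These functions are the coefficients of products of monomials. A nonzero value forces
  \<open>x\<close> into \<open>U t\<close> and \<open>h (- t) x\<close> into \<open>U s\<close>, and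
  \<open>domain_compose\<close> gives the new domain.\<close>

lemma translate_in_vanishing_ideal:
  assumes "a \<in> vanishing_ideal X (U t)" "b \<in> vanishing_ideal X (U s)"
  shows "(\<lambda>x. a x * b (h (- t) x)) \<in> vanishing_ideal X (U (t + s))"
proof -
  let ?f = "\<lambda>x. a x * b (h (- t) x)"
  have ca: "continuous_map X euclidean a" and cb: "continuous_map X euclidean b"
    and a0: "\<And>x. x \<notin> U t \<Longrightarrow> a x = 0" and b0: "\<And>x. x \<notin> U s \<Longrightarrow> b x = 0"
    using assms by (auto simp: vanishing_ideal_def cont_functions_def)
  have "continuous_map (subtopology X (U t)) euclidean ?f"
    using continuous_map_from_subtopology[OF ca]
      continuous_map_compose[OF continuous_map_partial cb, of t, unfolded comp_def]
    by (rule continuous_map_complex_mult)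
  then have "continuous_map X euclidean (\<lambda>x. if x \<in> U t then ?f x else 0)"
    using open_domain closed_domain by (intro continuous_map_if_clopen) auto
  moreover have "(\<lambda>x. if x \<in> U t then ?f x else 0) = ?f"
    by (simp add: fun_eq_iff a0)
  ultimately have "continuous_map X euclidean ?f"
    by simp
  moreover have "?f x = 0" if "x \<notin> U (t + s)" for x
    using that domain_compose[of x t s] a0[of x] b0[of "h (- t) x"] by auto
  ultimately show ?thesis
    using domain_subset[of "t + s"] by (auto simp: vanishing_ideal_def cont_functions_def)
qed

section \<open>The ring structure\<close>

lemma carrier_iff:
  "a \<in> carrier R \<longleftrightarrow> (\<forall>t. a t \<in> vanishing_ideal X (U t)) \<and> finite (coeff_support a)"
  by (simp add: partial_skew_group_ring_def)

lemma carrierD: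
  assumes "a \<in> carrier R"
  shows "a t \<in> vanishing_ideal X (U t)" "finite (coeff_support a)" "x \<notin> U t \<Longrightarrow> a t x = 0"
    "a t \<in> cont_functions X"
  using assms by (auto simp: carrier_iff vanishing_ideal_def)

lemma monomial_carrier: "f \<in> vanishing_ideal X (U t) \<Longrightarrow> monomial t f \<in> carrier R"
  using finite_subset[OF coeff_support_monomial[of t f]]
  by (auto simp: carrier_iff monomial_def zero_in_vanishing_ideal)

lemma coeff_support_conv:
  "coeff_support (conv h a b) \<subseteq> (\<lambda>(t, s). t + s) ` (coeff_support a \<times> coeff_support b)"
proof
  fix r assume "r \<in> coeff_support (conv h a b)"
  then obtain x where "conv h a b r x \<noteq> 0"
    by (auto simp: coeff_support_def)
  then obtain t where "t \<in> coeff_support a" "b (- t + r) (h (- t) x) \<noteq> 0"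
    unfolding conv_def by (metis (no_types, lifting) mult_eq_0_iff sum.neutral)
  then have "t \<in> coeff_support a" "- t + r \<in> coeff_support b"
    using coeff_support_zero by metis+
  then show "r \<in> (\<lambda>(t, s). t + s) ` (coeff_support a \<times> coeff_support b)"
    by (intro image_eqI[of _ _ "(t, - t + r)"]) (auto simp: add.assoc[symmetric])
qed

lemma conv_carrier:
  assumes "a \<in> carrier R" "b \<in> carrier R"
  shows "conv h a b \<in> carrier R"
  unfolding carrier_iff
proof (intro conjI allI)
  show "finite (coeff_support (conv h a b))"
    using assms coeff_support_conv carrierD(2) finite_subset by (metis finite_SigmaI finite_imageI)
  fix r
  have "(\<lambda>x. a t x * b (- t + r) (h (- t) x)) \<in> vanishing_ideal X (U r)" for t
    using translate_in_vanishing_ideal[of "a t" t "b (- t + r)" "- t + r"] assms carrierD(1)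
    by (simp add: add.assoc[symmetric])
  then show "conv h a b r \<in> vanishing_ideal X (U r)"
    unfolding conv_def using assms carrierD(2) by (intro vanishing_ideal_sum)
qed

text \<open>Since \<open>h t\<close> undoes \<open>h (- t)\<close> on \<open>U t\<close>, the
  monomial product reduces to \<open>a\<close> times the translate of \<open>b\<close> by
  \<open>h (- t)\<close>. The pairs with \<open>t + s = r\<close> are then indexed by
  \<open>t\<close> alone.\<close>

lemma skew_mult_eq_conv:
  assumes a: "a \<in> carrier R" and b: "b \<in> carrier R"
  shows "skew_mult U h a b = conv h a b"
proof (intro ext)
  fix r x
  let ?S = "{(t, s). t \<in> coeff_support a \<and> s \<in> coeff_support b \<and> t + s = r}"
  let ?T = "{t \<in> coeff_support a. - t + r \<in> coeff_support b}"
  have eq: "induced_map U h t (\<lambda>y. induced_map U h (- t) (a t) y * b s y) x = a t x * b s (h (- t) x)" for t s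
    using carrierD(3)[OF a] map_mem[of x t] map_cancel[of x t] by (auto simp: induced_map_def)
  have "skew_mult U h a b r x = (\<Sum>(t, s)\<in>?S. a t x * b s (h (- t) x))"
    by (simp add: skew_mult_def eq)
  also have "\<dots> = (\<Sum>t\<in>?T. a t x * b (- t + r) (h (- t) x))"
    by (rule sum.reindex_bij_witness[where i = "\<lambda>t. (t, - t + r)" and j = fst])
      (auto simp: add.assoc[symmetric])
  also have "\<dots> = conv h a b r x"
    unfolding conv_def using carrierD(2)[OF a]
    by (intro sum.mono_neutral_left) (auto simp: coeff_support_zero)
  finally show "skew_mult U h a b r x = conv h a b r x" .
qed

text \<open>Both sides expand to the double sum over \<open>t\<close> and \<open>s\<close> of
  \<open>a t x * b s (h (- t) x)\<close> times a value of \<open>\<phi>\<close> at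
  \<open>h (- (t + s)) x\<close>.\<close>

lemma conv_assoc:
  assumes a: "a \<in> carrier R" and b: "b \<in> carrier R"
  shows "conv h (conv h a b) \<phi> = conv h a (conv h b \<phi>)"
proof (intro ext)
  fix r x
  let ?A = "coeff_support a" and ?B = "coeff_support b"
  let ?T = "(\<lambda>(t, s). t + s) ` (?A \<times> ?B)"
  have fin: "finite ?A" "finite ?B" "finite ?T"
    using a b carrierD(2) by blast+
  have inner: "(\<Sum>u\<in>?T. a t x * b (- t + u) (h (- t) x) * \<phi> (- u + r) (h (- u) x)) =
      a t x * conv h b \<phi> (- t + r) (h (- t) x)" if t: "t \<in> ?A" for t
  proof -
    \<comment> \<open>With \<open>u = t + s\<close>, only the translate by \<open>t\<close> of the
      support of \<open>b\<close> contributes.\<close>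
    have "(\<Sum>u\<in>?T. a t x * b (- t + u) (h (- t) x) * \<phi> (- u + r) (h (- u) x)) =
        (\<Sum>u\<in>(+) t ` ?B. a t x * b (- t + u) (h (- t) x) * \<phi> (- u + r) (h (- u) x))"
    proof (rule sum.mono_neutral_right[OF fin(3)])
      show "\<forall>u\<in>?T - (+) t ` ?B. a t x * b (- t + u) (h (- t) x) * \<phi> (- u + r) (h (- u) x) = 0"
      proof
        fix u assume "u \<in> ?T - (+) t ` ?B"
        then have "- t + u \<notin> ?B"
          by (metis DiffD2 add_minus_cancel image_eqI)
        then show "a t x * b (- t + u) (h (- t) x) * \<phi> (- u + r) (h (- u) x) = 0"
          by (simp add: coeff_support_zero)
      qed
    qed (use t in auto)
    also have "\<dots> = (\<Sum>s\<in>?B. a t x * b s (h (- t) x) * \<phi> (- (t + s) + r) (h (- (t + s)) x))"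
      by (subst sum.reindex) (auto simp: add.assoc[symmetric])
    also have "\<dots> = (\<Sum>s\<in>?B. a t x * (b s (h (- t) x) * \<phi> (- s + (- t + r)) (h (- s) (h (- t) x))))"
    proof (rule sum.cong[OF refl])
      fix s
      show "a t x * b s (h (- t) x) * \<phi> (- (t + s) + r) (h (- (t + s)) x) =
          a t x * (b s (h (- t) x) * \<phi> (- s + (- t + r)) (h (- s) (h (- t) x)))"
      \<comment> \<open>Otherwise \<open>a t x\<close> or \<open>b s (h (- t) x)\<close> is 0, so
        the arbitrary values of the maps off their domains do no harm.\<close>
      proof (cases "x \<in> U t \<and> h (- t) x \<in> U s")
        case True
        then have "h (- s) (h (- t) x) = h (- (t + s)) x"
          using map_compose by blast
        moreover have "- s + (- t + r) = - (t + s) + r"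
          by (simp only: minus_add add.assoc)
        ultimately show ?thesis by (simp only: mult.assoc)
      qed (use a b carrierD(3) in auto)
    qed
    finally show ?thesis by (simp add: conv_def sum_distrib_left)
  qed
  have "conv h (conv h a b) \<phi> r x = (\<Sum>u\<in>?T. conv h a b u x * \<phi> (- u + r) (h (- u) x))"
    using fin(3) coeff_support_conv by (rule conv_superset)
  also have "\<dots> = (\<Sum>t\<in>?A. \<Sum>u\<in>?T. a t x * b (- t + u) (h (- t) x) * \<phi> (- u + r) (h (- u) x))"
    unfolding conv_def[of h a b] sum_distrib_right by (rule sum.swap)
  also have "\<dots> = (\<Sum>t\<in>?A. a t x * conv h b \<phi> (- t + r) (h (- t) x))"
    by (simp add: inner)
  finally show "conv h (conv h a b) \<phi> r x = conv h a (conv h b \<phi>) r x"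
    by (simp add: conv_def[of h a])
qed

lemma ring_simps:
  "a \<in> carrier R \<Longrightarrow> b \<in> carrier R \<Longrightarrow> a \<otimes>\<^bsub>R\<^esub> b = conv h a b"
  "a \<oplus>\<^bsub>R\<^esub> b = (\<lambda>t x. a t x + b t x)"
  "\<zero>\<^bsub>R\<^esub> = (\<lambda>t x. 0)"
  by (auto simp: skew_mult_eq_conv[symmetric] partial_skew_group_ring_def)

lemma indicator_in_vanishing_ideal:
  "(indicator (U t) :: 'x \<Rightarrow> complex) \<in> vanishing_ideal X (U t)"
proof -
  have "continuous_map X euclidean (\<lambda>x. if x \<in> U t then 1 else 0 :: complex)"
    using open_domain closed_domain by (intro continuous_map_if_clopen) auto
  moreover have "(\<lambda>x. if x \<in> U t then 1 else 0 :: complex) = indicator (U t)"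
    by (simp add: fun_eq_iff)
  ultimately have "continuous_map X euclidean (indicator (U t) :: 'x \<Rightarrow> complex)"
    by simp
  then show ?thesis
    using domain_subset[of t] by (auto simp: vanishing_ideal_def cont_functions_def indicator_def)
qed

lemma add_carrier:
  assumes "a \<in> carrier R" "b \<in> carrier R"
  shows "(\<lambda>t x. a t x + b t x) \<in> carrier R"
proof -
  have "coeff_support (\<lambda>t x. a t x + b t x) \<subseteq> coeff_support a \<union> coeff_support b"
    by (auto simp: coeff_support_def)
  then have "finite (coeff_support (\<lambda>t x. a t x + b t x))"
    by (rule finite_subset) (use assms carrierD(2) in blast)
  then show ?thesis
    using assms by (simp add: carrier_iff vanishing_ideal_add)
qed

lemma uminus_carrier: "a \<in> carrier R \<Longrightarrow> (\<lambda>t x. - a t x) \<in> carrier R"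
proof -
  assume "a \<in> carrier R"
  moreover have "coeff_support (\<lambda>t x. - a t x) = coeff_support a"
    by (auto simp: coeff_support_def fun_eq_iff)
  ultimately show ?thesis
    by (auto simp: carrier_iff vanishing_ideal_uminus)
qed

lemma zero_carrier: "(\<lambda>t x. 0) \<in> carrier R"
  by (auto simp: carrier_iff zero_in_vanishing_ideal coeff_support_def)

lemma one_eq: "\<one>\<^bsub>R\<^esub> = monomial 0 (indicator (U 0))"
  by (auto simp: partial_skew_group_ring_def monomial_def fun_eq_iff indicator_def domain_zero)

lemma one_carrier: "\<one>\<^bsub>R\<^esub> \<in> carrier R"
  by (simp add: one_eq monomial_carrier indicator_in_vanishing_ideal)

text \<open>Associativity is \<open>conv_assoc\<close> with the third ring element in the role of
  \<open>\<phi>\<close>.\<close>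

lemma ring_R: "ring R"
proof (rule ringI)
  show "abelian_group R"
  proof (rule abelian_groupI)
    show "\<exists>b\<in>carrier R. b \<oplus>\<^bsub>R\<^esub> a = \<zero>\<^bsub>R\<^esub>" if "a \<in> carrier R" for a
      using uminus_carrier[OF that] by (intro bexI[of _ "\<lambda>t x. - a t x"]) (simp_all add: ring_simps)
  qed (simp_all add: ring_simps(2,3) add_carrier zero_carrier add_ac)
  show "monoid R"
  proof (rule monoidI)
    fix a assume a: "a \<in> carrier R"
    have "conv h \<one>\<^bsub>R\<^esub> a r x = a r x" for r x
      using carrierD(3)[OF a, of x r] domain_subset[of r]
      by (cases "x \<in> topspace X") (auto simp: one_eq conv_monomial_left domain_zero map_zero)
    then show "\<one>\<^bsub>R\<^esub> \<otimes>\<^bsub>R\<^esub> a = a"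
      by (simp add: ring_simps(1) one_carrier a fun_eq_iff)
    \<comment> \<open>Off \<open>U r\<close> both sides vanish; on it \<open>h (- r) x\<close> is a
      point of the space, where the unit function is 1.\<close>
    have "conv h a \<one>\<^bsub>R\<^esub> r x = a r x" for r x
      using carrierD(3)[OF a, of x r] domain_subset[of "- r"] map_mem[of x r]
      by (cases "x \<in> U r") (auto simp: one_eq conv_monomial_right[OF carrierD(2)[OF a]] domain_zero)
    then show "a \<otimes>\<^bsub>R\<^esub> \<one>\<^bsub>R\<^esub> = a"
      by (simp add: ring_simps(1) one_carrier a fun_eq_iff)
  qed (simp_all add: ring_simps(1) conv_carrier one_carrier conv_assoc)
next
  fix a b c assume abc: "a \<in> carrier R" "b \<in> carrier R" "c \<in> carrier R"
  have "conv h (\<lambda>t x. a t x + b t x) c = (\<lambda>t x. conv h a c t x + conv h b c t x)"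
    using abc by (intro ext conv_add_left carrierD(2))
  then show "(a \<oplus>\<^bsub>R\<^esub> b) \<otimes>\<^bsub>R\<^esub> c = a \<otimes>\<^bsub>R\<^esub> c \<oplus>\<^bsub>R\<^esub> b \<otimes>\<^bsub>R\<^esub> c"
    using abc by (simp add: ring_simps(1,2) add_carrier)
  have "conv h c (\<lambda>t x. a t x + b t x) = (\<lambda>t x. conv h c a t x + conv h c b t x)"
    by (intro ext conv_add_right)
  then show "c \<otimes>\<^bsub>R\<^esub> (a \<oplus>\<^bsub>R\<^esub> b) = c \<otimes>\<^bsub>R\<^esub> a \<oplus>\<^bsub>R\<^esub> c \<otimes>\<^bsub>R\<^esub> b"
    using abc by (simp add: ring_simps(1,2) add_carrier)
qed

section \<open>Ideals of the ring\<close>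

lemma vanishing_ideal_zero: "vanishing_ideal X (U 0) = cont_functions X"
  by (auto simp: vanishing_ideal_def cont_functions_def domain_zero)

lemma idealI_conv:
  assumes sub: "I \<subseteq> carrier R" and zero: "(\<lambda>t x. 0) \<in> I"
    and add: "\<And>a b. a \<in> I \<Longrightarrow> b \<in> I \<Longrightarrow> (\<lambda>t x. a t x + b t x) \<in> I"
    and left: "\<And>a b. a \<in> I \<Longrightarrow> b \<in> carrier R \<Longrightarrow> conv h b a \<in> I"
    and right: "\<And>a b. a \<in> I \<Longrightarrow> b \<in> carrier R \<Longrightarrow> conv h a b \<in> I"
  shows "ideal I R"
proof -
  interpret R: ring R by (rule ring_R)
  have left': "b \<otimes>\<^bsub>R\<^esub> a \<in> I" if "a \<in> I" "b \<in> carrier R" for a b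
    using left[OF that] sub that by (simp add: ring_simps(1) subsetD)
  have right': "a \<otimes>\<^bsub>R\<^esub> b \<in> I" if "a \<in> I" "b \<in> carrier R" for a b
    using right[OF that] sub that by (simp add: ring_simps(1) subsetD)
  have "subgroup I (add_monoid R)"
  proof (rule group.subgroupI[OF R.a_group])
    fix a assume a: "a \<in> I"
    \<comment> \<open>The additive inverse is a product with the negative of the unit, so closure
      under products supplies it.\<close>
    have "\<ominus>\<^bsub>R\<^esub> \<one>\<^bsub>R\<^esub> \<otimes>\<^bsub>R\<^esub> a = \<ominus>\<^bsub>R\<^esub> a"
      using a sub by (simp add: R.l_minus subsetD)
    moreover have "\<ominus>\<^bsub>R\<^esub> \<one>\<^bsub>R\<^esub> \<otimes>\<^bsub>R\<^esub> a \<in> I"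
      using a by (intro left') simp_all
    ultimately show "inv\<^bsub>add_monoid R\<^esub> a \<in> I"
      by (simp only: a_inv_def)
  next
    fix a b assume "a \<in> I" "b \<in> I"
    then show "a \<otimes>\<^bsub>add_monoid R\<^esub> b \<in> I"
      using add by (simp add: ring_simps(2))
  qed (use sub zero in auto)
  then show ?thesis
    using left' right' by (intro idealI[OF ring_R])
qed

lemma ideal_carrier: "ideal I R \<Longrightarrow> a \<in> I \<Longrightarrow> a \<in> carrier R"
  by (rule additive_subgroup.a_Hcarr[OF ideal.axioms(1)])

lemma ideal_conv:
  assumes "ideal I R" "a \<in> I" "b \<in> carrier R"
  shows "conv h b a \<in> I" "conv h a b \<in> I"
  using ideal.I_l_closed[OF assms] ideal.I_r_closed[OF assms] ideal_carrier[OF assms(1,2)] assms(3)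
  by (simp_all add: ring_simps(1))

lemma ideal_add:
  assumes "ideal I R" "a \<in> I" "b \<in> I"
  shows "(\<lambda>t x. a t x + b t x) \<in> I"
  using additive_subgroup.a_closed[OF ideal.axioms(1)[OF assms(1)] assms(2,3)]
  by (simp add: ring_simps(2))

lemma conv_one: "conv h \<one>\<^bsub>R\<^esub> \<phi> r x = (if x \<in> topspace X then \<phi> r x else 0)"
  by (simp add: one_eq conv_monomial_left domain_zero map_zero)

section \<open>Simplicity forces topological freeness and minimality\<close>

lemma simple_imp_topologically_free:
  assumes X: "compact_space X" "Hausdorff_space X" and simple: "simple_ring R"
  shows "topologically_free X U h"
  unfolding topologically_free_def
proof (intro allI impI, rule ccontr)
  fix t :: 'g assume t: "t \<noteq> 0"
  let ?W = "X interior_of {x \<in> U (- t). h t x = x}"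
  assume "?W \<noteq> {}"
  then obtain x where x: "x \<in> ?W" by blast
  \<comment> \<open>A fixed point of \<open>h t\<close> is its own image, hence lies in
    \<open>U t\<close>, and \<open>h (- t)\<close> fixes it too.\<close>
  have W: "y \<in> topspace X \<and> y \<in> U t \<and> h (- t) y = y" if "y \<in> ?W" for y
  proof -
    have y: "y \<in> U (- t)" "h t y = y"
      using that interior_of_subset[of X "{x \<in> U (- t). h t x = x}"] by auto
    then have "y \<in> U t"
      using map_image[of t] by force
    then show ?thesis
      using y map_cancel[of y "- t"] domain_subset[of t] by auto
  qed
  obtain f where f: "f \<in> vanishing_ideal X ?W" "f x = 1"
    using compact_Hausdorff_bump[OF X openin_interior_of x] by blast
  have f0: "f y = 0" if "y \<notin> ?W" for y
    using f(1) that by (auto simp: vanishing_ideal_def)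
  have "f \<in> vanishing_ideal X (U 0)" "f \<in> vanishing_ideal X (U t)"
    using f(1) W by (auto simp: vanishing_ideal_def domain_zero)
  then have fm: "monomial 0 f \<in> carrier R" "monomial t (\<lambda>y. - f y) \<in> carrier R"
    using vanishing_ideal_uminus by (auto intro: monomial_carrier)
  define a where "a = (\<lambda>r y. monomial 0 f r y + monomial t (\<lambda>y. - f y) r y)"
  have a: "a \<in> carrier R"
    unfolding a_def by (rule add_carrier[OF fm])
  \<comment> \<open>The kernel of the action on functions on \<open>X\<close>: such a function is
    encoded as a family that ignores the group variable.\<close>
  define I where "I = {b \<in> carrier R. \<forall>\<phi> r x. conv h b (\<lambda>_. \<phi>) r x = 0}"
  have "ideal I R"
  proof (rule idealI_conv)
    fix b c assume b: "b \<in> I" and c: "c \<in> carrier R"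
    have b': "b \<in> carrier R" and "conv h b (\<lambda>_. \<phi>) = (\<lambda>r x. 0)" for \<phi>
      using b by (auto simp: I_def fun_eq_iff)
    then show "conv h c b \<in> I"
      using conv_carrier[OF c b'] by (simp add: I_def conv_assoc[OF c b']) (simp add: conv_def)
    \<comment> \<open>The image of a constant family is again a constant family, so \<open>b\<close>
      annihilates it as well.\<close>
    have const: "conv h c (\<lambda>_. \<phi>) = (\<lambda>_. conv h c (\<lambda>_. \<phi>) 0)" for \<phi>
      by (simp add: conv_def)
    have "conv h b (conv h c (\<lambda>_. \<phi>)) r y = 0" for \<phi> r y
      by (subst const) (use b in \<open>simp add: I_def\<close>)
    then show "conv h b c \<in> I"
      using conv_carrier[OF b' c] by (simp add: I_def conv_assoc[OF b' c])
  next
    fix b c assume "b \<in> I" "c \<in> I"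
    then show "(\<lambda>t x. b t x + c t x) \<in> I"
      by (simp add: I_def add_carrier conv_add_left carrierD(2))
  qed (auto simp: I_def zero_carrier conv_def)
  then have "I = {\<zero>\<^bsub>R\<^esub>} \<or> I = carrier R"
    using simple simple_ring.trivial_ideals by blast
  moreover have "\<one>\<^bsub>R\<^esub> \<notin> I"
  proof
    assume "\<one>\<^bsub>R\<^esub> \<in> I"
    \<comment> \<open>Test function: the constant 1, which the unit preserves at every point of
      \<open>X\<close>.\<close>
    then have "conv h \<one>\<^bsub>R\<^esub> (\<lambda>_ _. 1) 0 x = 0"
      unfolding I_def by blast
    then show False
      using W[OF x] by (simp add: conv_one)
  qed
  moreover have "a \<in> I"
  proof -
    have "conv h a (\<lambda>_. \<phi>) r y = 0" for \<phi> r y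
    proof -
      have "conv h a (\<lambda>_. \<phi>) r y = f y * \<phi> (h (- 0) y) + - f y * \<phi> (h (- t) y)"
        unfolding a_def by (simp add: conv_add_left carrierD(2)[OF fm(1)] carrierD(2)[OF fm(2)] conv_monomial_left)
      \<comment> \<open>On \<open>?W\<close> the map \<open>h (- t)\<close> is the identity and the
        two terms cancel; elsewhere \<open>f\<close> is 0.\<close>
      also have "\<dots> = 0"
        using W[of y] f0[of y] by (cases "y \<in> ?W") (auto simp: map_zero)
      finally show ?thesis .
    qed
    then show ?thesis using a by (simp add: I_def)
  qed
  ultimately have "a = (\<lambda>t x. 0)"
    using one_carrier by (auto simp: ring_simps(3))
  then have "a 0 x = 0" by simp
  then show False
    using t f(2) by (simp add: a_def monomial_def)
qed

lemma simple_imp_minimal: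
  assumes X: "compact_space X" "Hausdorff_space X" and simple: "simple_ring R"
  shows "minimal_action X U h"
  unfolding minimal_action_def
proof (intro allI impI, elim conjE)
  fix V assume V: "openin X V" "invariant_set U h V"
  define I where "I = {a \<in> carrier R. \<forall>t x. x \<notin> V \<longrightarrow> a t x = 0}"
  \<comment> \<open>If \<open>h (- t) x\<close> were in \<open>V\<close>, invariance under
    \<open>h t\<close> would bring \<open>x\<close> back into \<open>V\<close>.\<close>
  have notin: "h (- t) x \<notin> V" if "x \<notin> V" "x \<in> U t" for t x
    using that V(2) map_mem[of x t] map_cancel[of x t] unfolding invariant_set_def by fastforce
  have "ideal I R"
  proof (rule idealI_conv)
    fix a b assume a: "a \<in> I" and b: "b \<in> carrier R"
    then have a': "a \<in> carrier R" and a0: "\<And>t x. x \<notin> V \<Longrightarrow> a t x = 0"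
      by (auto simp: I_def)
    \<comment> \<open>Either \<open>x\<close> is outside \<open>U t\<close> and \<open>b t x\<close>
      is 0, or \<open>h (- t) x\<close> is again outside \<open>V\<close>.\<close>
    have "b t x * a s (h (- t) x) = 0" if "x \<notin> V" for t s x
      using notin[OF that, of t] a0 carrierD(3)[OF b, of x t] by auto
    then have "conv h b a r x = 0" if "x \<notin> V" for r x
      unfolding conv_def using that by (intro sum.neutral) blast
    then show "conv h b a \<in> I"
      using conv_carrier[OF b a'] by (simp add: I_def)
    show "conv h a b \<in> I"
      using conv_carrier[OF a' b] a0 by (simp add: I_def conv_def)
  qed (auto simp: I_def zero_carrier add_carrier)
  then consider "I = {\<zero>\<^bsub>R\<^esub>}" | "I = carrier R"
    using simple simple_ring.trivial_ideals by blast
  then show "V = {} \<or> V = topspace X"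
  proof cases
    case 1
    \<comment> \<open>A bump function at a point of \<open>V\<close>, supported in \<open>V\<close>,
      would be a nonzero element of \<open>I\<close>.\<close>
    have "False" if "x \<in> V" for x
    proof -
      obtain f where f: "f \<in> vanishing_ideal X V" "f x = 1"
        using compact_Hausdorff_bump[OF X V(1) \<open>x \<in> V\<close>] by blast
      then have "monomial 0 f \<in> I"
        using monomial_carrier[of f 0]
        by (auto simp: I_def vanishing_ideal_zero) (auto simp: vanishing_ideal_def monomial_def)
      then have "monomial (0 :: 'g) f 0 x = 0"
        using 1 by (simp add: ring_simps(3))
      then show False using f(2) by (simp add: monomial_def)
    qed
    then show ?thesis by blast
  next
    case 2
    then have "\<forall>x. x \<notin> V \<longrightarrow> \<one>\<^bsub>R\<^esub> 0 x = 0"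
      using one_carrier by (auto simp: I_def)
    then have "topspace X \<subseteq> V"
      by (auto simp: one_eq monomial_def domain_zero indicator_def split: if_splits)
    then show ?thesis
      using openin_subset[OF V(1)] by blast
  qed
qed

section \<open>Freeness and minimality force simplicity\<close>

text \<open>Induction on \<open>T\<close>: each new index costs one further shrinking, and the
  conditions already obtained pass to smaller sets.\<close>

lemma topologically_free_shrink:
  assumes free: "topologically_free X U h" and haus: "Hausdorff_space X"
    and "finite T" "0 \<notin> T" "openin X W" "W \<noteq> {}"
  obtains W' where "openin X W'" "W' \<noteq> {}" "W' \<subseteq> W"
    "\<And>t y. t \<in> T \<Longrightarrow> y \<in> W' \<Longrightarrow> y \<in> U t \<Longrightarrow> h (- t) y \<notin> W'"
proof -
  have "\<exists>W'. openin X W' \<and> W' \<noteq> {} \<and> W' \<subseteq> W \<and> (\<forall>t\<in>T. \<forall>y\<in>W'. y \<in> U t \<longrightarrow> h (- t) y \<notin> W')"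
    using \<open>finite T\<close> \<open>0 \<notin> T\<close>
  proof (induction T)
    case empty
    then show ?case using assms by blast
  next
    case (insert t T)
    then obtain W1 where W1: "openin X W1" "W1 \<noteq> {}" "W1 \<subseteq> W"
        "\<forall>t\<in>T. \<forall>y\<in>W1. y \<in> U t \<longrightarrow> h (- t) y \<notin> W1"
      by auto
    show ?case
    proof (cases "W1 \<inter> U t = {}")
      case True
      then show ?thesis using W1 by blast
    next
      case False
      \<comment> \<open>Freeness speaks of \<open>h t\<close> on \<open>U (- t)\<close>, hence its
        use at \<open>- t\<close>.\<close>
      have "X interior_of {x \<in> U t. h (- t) x = x} = {}"
        using free[unfolded topologically_free_def, rule_format, of "- t"] insert.prems by auto
      moreover have "openin X (W1 \<inter> U t)"
        using W1(1) open_domain by blast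
      ultimately obtain x where x: "x \<in> W1" "x \<in> U t" "h (- t) x \<noteq> x"
        using False unfolding interior_of_eq_empty by blast
      then have "x \<in> topspace X" "h (- t) x \<in> topspace X"
        using map_mem[of x t] domain_subset by blast+
      then obtain A B where AB: "openin X A" "openin X B" "x \<in> A" "h (- t) x \<in> B" "disjnt A B"
        using haus x(3) unfolding Hausdorff_space_def by metis
      \<comment> \<open>Points of this set lie in \<open>A\<close> while \<open>h (- t)\<close>
        sends them into \<open>B\<close>, disjoint from \<open>A\<close>.\<close>
      let ?W = "W1 \<inter> A \<inter> {y \<in> U t. h (- t) y \<in> B}"
      have "openin X ?W"
        using W1(1) AB(1) openin_preimage[OF AB(2), of t] by blast
      moreover have "x \<in> ?W"
        using x AB by blast
      moreover have "\<forall>s\<in>insert t T. \<forall>y\<in>?W. y \<in> U s \<longrightarrow> h (- s) y \<notin> ?W"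
        using W1(4) AB(5) by (auto simp: disjnt_iff)
      ultimately show ?thesis
        using W1(3) by (intro exI[of _ ?W]) blast
    qed
  qed
  then show thesis using that by blast
qed

text \<open>Detects nonzero ideals on the diagonal copy of C(X), so that the rest of the argument
  concerns functions on \<open>X\<close> alone.\<close>

lemma ideal_intersection_property:
  assumes X: "compact_space X" "Hausdorff_space X" and free: "topologically_free X U h"
    and I: "ideal I R" and nz: "I \<noteq> {\<zero>\<^bsub>R\<^esub>}"
  obtains c x where "monomial 0 c \<in> I" "c x \<noteq> 0"
proof -
  have "\<zero>\<^bsub>R\<^esub> \<in> I"
    using additive_subgroup.zero_closed[OF ideal.axioms(1)[OF I]] .
  then obtain b where b: "b \<in> I" "b \<noteq> (\<lambda>t x. 0)"
    using nz by (auto simp: ring_simps(3))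
  then obtain t x where btx: "b t x \<noteq> 0"
    by (metis ext)
  have bc: "b \<in> carrier R"
    using ideal_carrier[OF I b(1)] .
  \<comment> \<open>Shifts the nonzero coefficient \<open>b t\<close> to index 0; the indicator is 1
    at \<open>h (- t) x\<close> for \<open>x\<close> in \<open>U t\<close>, so no value is
    lost.\<close>
  define a where "a = conv h b (monomial (- t) (indicator (U (- t))))"
  have aI: "a \<in> I"
    unfolding a_def by (intro ideal_conv(2)[OF I b(1)] monomial_carrier indicator_in_vanishing_ideal)
  then have a: "a \<in> carrier R"
    using ideal_carrier[OF I] by blast
  have "x \<in> U t"
    using btx carrierD(3)[OF bc] by blast
  then have "a 0 x \<noteq> 0"
    using btx map_mem[of x t] unfolding a_def
    by (subst conv_monomial_right[OF carrierD(2)[OF bc]]) (simp add: indicator_def)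
  then have "{y. a 0 y \<noteq> 0} \<noteq> {}" by blast
  then obtain W where W: "openin X W" "W \<noteq> {}" "W \<subseteq> {y. a 0 y \<noteq> 0}"
    and disj: "\<And>t y. t \<in> coeff_support a - {0} \<Longrightarrow> y \<in> W \<Longrightarrow> y \<in> U t \<Longrightarrow> h (- t) y \<notin> W"
    using topologically_free_shrink[OF free X(2), of "coeff_support a - {0}" "{y. a 0 y \<noteq> 0}"]
      openin_nonzero[OF carrierD(4)[OF a]] carrierD(2)[OF a] by auto
  then obtain z where z: "z \<in> W" by blast
  obtain f where f: "f \<in> vanishing_ideal X W" "f z = 1"
    using compact_Hausdorff_bump[OF X W(1) z] by blast
  then have f0: "f y = 0" if "y \<notin> W" for y
    using that by (simp add: vanishing_ideal_def)
  have fm: "monomial 0 f \<in> carrier R"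
    using f(1) by (intro monomial_carrier) (simp add: vanishing_ideal_zero, simp add: vanishing_ideal_def)
  have "conv h (monomial 0 f) (conv h a (monomial 0 f)) = monomial 0 (\<lambda>y. f y * (a 0 y * f y))"
  proof (intro ext)
    fix r y
    have "conv h (monomial 0 f) (conv h a (monomial 0 f)) r y = f y * (a r y * f (h (- r) y))"
      using f0[of y] openin_subset[OF W(1)]
      by (cases "y \<in> W") (auto simp: map_zero subsetD conv_monomial_left conv_monomial_right[OF carrierD(2)[OF a]] map_zero)
    also have "\<dots> = monomial 0 (\<lambda>y. f y * (a 0 y * f y)) r y"
    proof (cases "r = 0")
      case True
      then show ?thesis
        using f0[of y] openin_subset[OF W(1)] by (cases "y \<in> W") (auto simp: monomial_def map_zero subsetD)
    next
      case False
      \<comment> \<open>A nonzero value would need \<open>y\<close> and \<open>h (- r) y\<close>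
        both in \<open>W\<close>, with \<open>y\<close> in \<open>U r\<close> and \<open>r\<close>
        in the support of \<open>a\<close>, against the choice of \<open>W\<close>.\<close>
      have "f y * (a r y * f (h (- r) y)) = 0"
        using f0[of y] f0[of "h (- r) y"] disj[of r y] False carrierD(3)[OF a, of y r]
          coeff_support_zero[of r a y] by auto
      then show ?thesis using False by (simp add: monomial_def)
    qed
    finally show "conv h (monomial 0 f) (conv h a (monomial 0 f)) r y =
        monomial 0 (\<lambda>y. f y * (a 0 y * f y)) r y" .
  qed
  then have "monomial 0 (\<lambda>y. f y * (a 0 y * f y)) \<in> I"
    using ideal_conv(1)[OF I ideal_conv(2)[OF I aI fm] fm] by simp
  moreover have "f z * (a 0 z * f z) \<noteq> 0"
    using z W(3) f(2) by auto
  ultimately show thesis using that by blast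
qed

text \<open>Together with \<open>ideal_monomial_add\<close>: the diagonal part of an ideal is an
  ideal of C(X).\<close>

lemma ideal_monomial_mult:
  assumes "ideal I R" "monomial 0 c \<in> I" "g \<in> cont_functions X"
  shows "monomial 0 (\<lambda>x. g x * c x) \<in> I"
proof -
  have "conv h (monomial 0 g) (monomial 0 c) \<in> I"
    using assms by (intro ideal_conv(1) monomial_carrier) (simp_all add: vanishing_ideal_zero)
  moreover have "g x * c (h 0 x) = g x * c x" for x
    using assms(3) by (cases "x \<in> topspace X") (auto simp: cont_functions_def map_zero)
  then have "conv h (monomial 0 g) (monomial 0 c) r x = monomial 0 (\<lambda>x. g x * c x) r x" for r x
    by (simp add: conv_monomial_left) (simp add: monomial_def)
  then have "conv h (monomial 0 g) (monomial 0 c) = monomial 0 (\<lambda>x. g x * c x)"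
    by (intro ext)
  ultimately show ?thesis by simp
qed

lemma ideal_monomial_add:
  assumes "ideal I R" "monomial 0 c \<in> I" "monomial 0 d \<in> I"
  shows "monomial 0 (\<lambda>x. c x + d x) \<in> I"
proof -
  have "monomial (0 :: 'g) (\<lambda>x. c x + d x) = (\<lambda>t x. monomial 0 c t x + monomial 0 d t x)"
    by (auto simp: monomial_def fun_eq_iff)
  then show ?thesis using ideal_add[OF assms] by simp
qed

text \<open>Multiplying by the indicator monomials at \<open>t\<close> on the left and at
  \<open>- t\<close> on the right implements \<open>\<alpha>\<close> at \<open>t\<close> on the
  diagonal. This yields the invariance of the open set to which minimality is applied.\<close>

lemma ideal_monomial_translate:
  assumes I: "ideal I R" and c: "monomial 0 c \<in> I"
  shows "monomial 0 (\<lambda>x. if x \<in> U t then c (h (- t) x) else 0) \<in> I"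
proof -
  let ?l = "monomial t (indicator (U t))" and ?r = "monomial (- t) (indicator (U (- t)))"
  have m: "?l \<in> carrier R" "?r \<in> carrier R"
    by (intro monomial_carrier indicator_in_vanishing_ideal)+
  have fin: "finite (coeff_support (monomial (0 :: 'g) c))"
    using carrierD(2)[OF ideal_carrier[OF I c]] .
  have "conv h ?l (conv h (monomial 0 c) ?r) r x =
      monomial 0 (\<lambda>x. if x \<in> U t then c (h (- t) x) else 0) r x" for r x
  proof (cases "x \<in> U t")
    case True
    \<comment> \<open>The index is a conjugate of \<open>r\<close>, so it is 0 only for
      \<open>r = 0\<close>.\<close>
    have "- t + r - - t = 0 \<longleftrightarrow> r = 0"
      using add_left_cancel[of "- t" r 0] by (simp only: right_minus_eq add_0_right)
    moreover have "conv h ?l (conv h (monomial 0 c) ?r) r x =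
        monomial 0 c (- t + r - - t) (h (- t) x) * indicator (U (- t)) (h (- (- t + r - - t)) (h (- t) x))"
      by (subst conv_monomial_left, subst conv_monomial_right[OF fin]) (use True in simp)
    ultimately show ?thesis
      using True map_mem[OF True] domain_subset[of "- t"]
      by (cases "r = 0") (auto simp: monomial_def map_zero)
  next
    case False
    then show ?thesis
      by (subst conv_monomial_left) (simp add: monomial_def)
  qed
  then have "conv h ?l (conv h (monomial 0 c) ?r) = monomial 0 (\<lambda>x. if x \<in> U t then c (h (- t) x) else 0)"
    by (intro ext)
  then show ?thesis
    using ideal_conv(1)[OF I ideal_conv(2)[OF I c m(2)] m(1)] by simp
qed

lemma free_minimal_imp_simple:
  assumes X: "compact_space X" "Hausdorff_space X" and free: "topologically_free X U h"
    and min: "minimal_action X U h"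
  shows "simple_ring R"
proof (rule simple_ring.intro[OF ring_R], unfold_locales)
  fix I assume I: "ideal I R"
  show "I = {\<zero>\<^bsub>R\<^esub>} \<or> I = carrier R"
  proof (cases "I = {\<zero>\<^bsub>R\<^esub>}")
    case nz: False
    define J where "J = {c. monomial 0 c \<in> I}"
    have J: "c \<in> cont_functions X" if "c \<in> J" for c
      using carrierD(4)[OF ideal_carrier[OF I], of "monomial 0 c" 0] that
      by (simp add: J_def monomial_def)
    define V where "V = (\<Union>c\<in>J. {x. c x \<noteq> 0})"
    have "openin X V"
      unfolding V_def using openin_nonzero[OF J] by blast
    moreover have "invariant_set U h V"
      unfolding invariant_set_def
    proof (intro allI subsetI)
      fix t y assume "y \<in> h t ` (V \<inter> U (- t))"
      then obtain x c where x: "y = h t x" "x \<in> U (- t)" and c: "c \<in> J" "c x \<noteq> 0"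
        by (auto simp: V_def)
      \<comment> \<open>The translate of \<open>c\<close> takes the nonzero value \<open>c x\<close>
        at \<open>y\<close>.\<close>
      let ?c = "\<lambda>x. if x \<in> U t then c (h (- t) x) else 0"
      have "?c \<in> J"
        using ideal_monomial_translate[OF I] c(1) by (simp add: J_def)
      moreover have "y \<in> U t" "h (- t) y = x"
        using x map_image[of t] map_cancel[of x "- t"] by auto
      ultimately show "y \<in> V"
        using c(2) unfolding V_def by (intro UN_I[of ?c]) simp_all
    qed
    moreover have "V \<noteq> {}"
      using ideal_intersection_property[OF X free I nz] by (auto simp: V_def J_def)
    ultimately have V: "V = topspace X"
      using min by (auto simp: minimal_action_def)
    define \<U> where "\<U> = (\<lambda>c. {x. c x \<noteq> 0}) ` J"
    have "\<forall>W\<in>\<U>. openin X W"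
      by (auto simp: \<U>_def intro: openin_nonzero J)
    moreover have "topspace X \<subseteq> \<Union>\<U>"
      using V by (simp add: \<U>_def V_def)
    ultimately obtain \<F> where "finite \<F>" "\<F> \<subseteq> \<U>" "topspace X \<subseteq> \<Union>\<F>"
      using X(1)[unfolded compact_space_alt, rule_format, of \<U>] by auto
    then obtain F where F: "finite F" "F \<subseteq> J" "topspace X \<subseteq> (\<Union>c\<in>F. {x. c x \<noteq> 0})"
      using finite_subset_image[of \<F> "\<lambda>c. {x. c x \<noteq> 0}" J] unfolding \<U>_def by auto
    \<comment> \<open>Squared moduli rule out cancellation: \<open>q\<close> is positive wherever
      some member of \<open>F\<close> is nonzero.\<close>
    define q where "q = (\<lambda>x. \<Sum>c\<in>F. (cmod (c x))\<^sup>2)"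
    have "(\<lambda>x. complex_of_real (q x)) \<in> J"
      unfolding q_def using F(1,2)
    proof (induction F)
      case empty
      then show ?case
        using additive_subgroup.zero_closed[OF ideal.axioms(1)[OF I]]
        by (simp add: J_def ring_simps(3) monomial_def if_distrib cong: if_cong)
    next
      case (insert c F)
      \<comment> \<open>The squared modulus is \<open>cnj (c x) * c x\<close>, a multiple of
        \<open>c\<close> by a continuous function.\<close>
      have "(\<lambda>x. cnj (c x)) \<in> cont_functions X"
        using J[of c] insert.prems by (auto simp: cont_functions_def continuous_map_atin tendsto_cnj)
      then have "(\<lambda>x. cnj (c x) * c x) \<in> J"
        using ideal_monomial_mult[OF I] insert.prems by (simp add: J_def)
      then have "(\<lambda>x. cnj (c x) * c x + complex_of_real (\<Sum>c\<in>F. (cmod (c x))\<^sup>2)) \<in> J"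
        using ideal_monomial_add[OF I] insert by (simp add: J_def)
      moreover have "cnj z * z = complex_of_real ((cmod z)\<^sup>2)" for z
        by (metis complex_norm_square mult.commute)
      ultimately show ?case
        using insert.hyps by simp
    qed
    moreover have q: "q x \<noteq> 0" if x: "x \<in> topspace X" for x
    proof -
      obtain c where "c \<in> F" "c x \<noteq> 0" using F(3) x by blast
      then have "0 < q x"
        unfolding q_def using F(1) by (intro sum_pos2[of _ c]) auto
      then show ?thesis by simp
    qed
    ultimately have qC: "(\<lambda>x. complex_of_real (q x)) \<in> cont_functions X"
      and qI: "monomial 0 (\<lambda>x. complex_of_real (q x)) \<in> I"
      using J by (auto simp: J_def)
    \<comment> \<open>Off the space \<open>q\<close> is 0 and \<open>inverse 0 = 0\<close>, so the
      inverse is still extended by 0 there.\<close>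
    have "(\<lambda>x. inverse (complex_of_real (q x))) \<in> cont_functions X"
      using qC q by (auto simp: cont_functions_def continuous_map_atin intro!: tendsto_inverse)
    then have "monomial 0 (\<lambda>x. inverse (complex_of_real (q x)) * complex_of_real (q x)) \<in> I"
      by (rule ideal_monomial_mult[OF I qI])
    moreover have "(\<lambda>x. inverse (complex_of_real (q x)) * complex_of_real (q x)) = indicator (U 0)"
      using q qC by (auto simp: fun_eq_iff indicator_def domain_zero cont_functions_def)
    ultimately show ?thesis
      using ideal.one_imp_carrier[OF I] by (simp add: one_eq)
  qed simp
qed

end

theorem theorem4p2:
  fixes X :: "'x topology"
    and U :: "'g::ab_group_add \<Rightarrow> 'x set"
    and h :: "'g \<Rightarrow> 'x \<Rightarrow> 'x"
  assumes "compact_space X" and "Hausdorff_space X"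
    and "topological_partial_action X U h"
    and "\<And>t. openin X (U t) \<and> closedin X (U t)"
  shows "simple_ring (partial_skew_group_ring X U h) \<longleftrightarrow>
         topologically_free X U h \<and> minimal_action X U h"
proof -
  interpret clopen_partial_action X U h
    using assms(3,4) by (simp add: clopen_partial_action_def clopen_partial_action_axioms_def)
  show ?thesis
    using simple_imp_topologically_free simple_imp_minimal free_minimal_imp_simple assms(1,2) by blast
qed

end
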